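(* There is a universal constant $c>0$ such that the following holds. Let $n$ be even, let $R>1$, and let $F$ be an $n\times n$ (real) Fourier transform matrix as described in the context. If an $R$-uniformly well conditioned layered circuit on $n$ variables computes a linear transformation proportional to $F$ (i.e. its final defining matrix $M_m$ equals $\lambda F$ for some nonzero real $\lambda$), then the number of rotation gates in the circuit is at least $c\,R^{-1} n\log n$; that is, the number of rotations is $\Omega(R^{-1}n\log n)$.
   Context: All logarithms are base $2$. Here $F$ denotes either of the following real orthogonal $n\times n$ matrices ($n$ even): (1) the matrix of the normalized complex discrete Fourier transform of order $n/2$, $\hat F(k,\ell)=(n/2)^{-1/2}e^{-2\pi i (k-1)(\ell-1)/(n/2)}$, acting on $\hat x\in\mathbb C^{n/2}$, written as a real linear map on $\mathbb R^n$ by storing the real part of $\hat x$ in $n/2$ coordinates and the imaginary part in the remaining $n/2$ (same for the output); or (2) the normalized Walsh–Hadamard matrix, where $n$ is a power of two and $F(i,j)=n^{-1/2}(-1)^{\langle [i-1],[j-1]\rangle}$, with $[a]$ the binary representation of $a\in\{0,\dots,n-1\}$ and $\langle\cdot,\cdot\rangle$ the dot product over $\mathbb Z_2$. A layered circuit of depth $m$ on $n$ variables consists of layers $L_0,\dots,L_m\in\mathbb R^n$ ($L_0$ the input, $L_m$ the output) and gates $i=1,\dots,m$ of two types. A rotation gate is given by indices $k_i<\ell_i$ in $[n]$ and an angle $\theta_i$: $L_i(j)=L_{i-1}(j)$ for $j\notin\{k_i,\ell_i\}$ and $(L_i(k_i),L_i(\ell_i))^T=A_i(L_{i-1}(k_i),L_{i-1}(\ell_i))^T$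 with $A_i=\begin{pmatrix}\cos\theta_i&\sin\theta_i\\-\sin\theta_i&\cos\theta_i\end{pmatrix}$. A constant gate is given by an index $k_i\in[n]$ and a nonzero real $c_i$: $L_i(j)=L_{i-1}(j)$ for $j\ne k_i$ and $L_i(k_i)=c_iL_{i-1}(k_i)$. The $i$-th defining matrix $M_i$ is the matrix mapping $L_0$ to $L_i$ (so $M_0=\mathrm{Id}$). The circuit is $R$-uniformly well conditioned if $\max_{i\in[m]}\|M_i\|\cdot\|M_i^{-1}\|\le R$, where $\|\cdot\|$ is the spectral norm.
   Formalization: The case n = 2 of the complex discrete Fourier transform (order 1) is excluded: there F is the identity, which the empty circuit computes with no rotations, so the stated bound fails. *)

theory Defs
  imports
    Complex_Main
    "HOL-Combinatorics.Permutations"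
    "Jordan_Normal_Form.Determinant"
begin

text \<open>Coordinates are numbered from 0, so the index set \<open>[n]\<close> is \<open>{..<n}\<close> throughout.\<close>

definition euclidean_norm :: "real vec \<Rightarrow> real" where
  "euclidean_norm v = sqrt (v \<bullet> v)"

definition spectral_norm :: "real mat \<Rightarrow> real" where
  "spectral_norm A =
     (SUP v\<in>{v \<in> carrier_vec (dim_col A). euclidean_norm v \<le> 1}. euclidean_norm (A *\<^sub>v v))"

text \<open>Meaningful for invertible matrices only; see \<open>mat_inverse_defining_mat\<close> below.\<close>

definition condition_number :: "real mat \<Rightarrow> real" where
  "condition_number A = spectral_norm A * spectral_norm (the (mat_inverse A))"

definition dft_mat :: "nat \<Rightarrow> complex mat" where
  "dft_mat N = mat N N (\<lambda>(k, l).
     of_real (1 / sqrt (real N)) *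
       exp (- 2 * of_real pi * \<i> * of_nat k * of_nat l / of_nat N))"

text \<open>A vector in \<open>\<complex>\<^bsup>n/2\<^esup>\<close> is stored as a vector in \<open>\<real>\<^sup>n\<close>. The permutation \<open>\<sigma>\<close> says where:
  coordinate \<open>j\<close> holds the real part of entry \<open>\<sigma> j\<close> if \<open>\<sigma> j < n/2\<close>, and the imaginary part
  of entry \<open>\<sigma> j - n/2\<close> otherwise. The identity gives ``real parts first, then imaginary parts''.\<close>

definition store_complex :: "nat \<Rightarrow> (nat \<Rightarrow> nat) \<Rightarrow> complex vec \<Rightarrow> real vec" where
  "store_complex n \<sigma> x = vec n (\<lambda>j.
     if \<sigma> j < n div 2 then Re (x $ \<sigma> j) else Im (x $ (\<sigma> j - n div 2)))"

definition is_real_dft_mat :: "nat \<Rightarrow> real mat \<Rightarrow> bool" where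
  "is_real_dft_mat n F \<longleftrightarrow> even n \<and> F \<in> carrier_mat n n \<and>
     (\<exists>\<sigma>. \<sigma> permutes {..<n} \<and>
        (\<forall>x \<in> carrier_vec (n div 2).
           F *\<^sub>v store_complex n \<sigma> x = store_complex n \<sigma> (dft_mat (n div 2) *\<^sub>v x)))"

definition binary_dot :: "nat \<Rightarrow> nat \<Rightarrow> nat \<Rightarrow> nat" where
  "binary_dot r a b = (\<Sum>t<r. of_bool (bit a t) * of_bool (bit b t)) mod 2"

definition is_walsh_hadamard_mat :: "nat \<Rightarrow> real mat \<Rightarrow> bool" where
  "is_walsh_hadamard_mat n F \<longleftrightarrow>
     (\<exists>r. n = 2 ^ r \<and> F = mat n n (\<lambda>(i, j). 1 / sqrt (real n) * (- 1) ^ binary_dot r i j))"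

definition is_fourier_mat :: "nat \<Rightarrow> real mat \<Rightarrow> bool" where
  "is_fourier_mat n F \<longleftrightarrow> is_real_dft_mat n F \<or> is_walsh_hadamard_mat n F"

datatype gate = is_Rotation: Rotation nat nat real | Constant nat real

fun gate_on :: "nat \<Rightarrow> gate \<Rightarrow> bool" where
  "gate_on n (Rotation k l \<theta>) \<longleftrightarrow> k < l \<and> l < n"
| "gate_on n (Constant k c) \<longleftrightarrow> k < n \<and> c \<noteq> 0"

fun apply_gate :: "gate \<Rightarrow> real vec \<Rightarrow> real vec" where
  "apply_gate (Rotation k l \<theta>) v = vec (dim_vec v) (\<lambda>j.
     if j = k then cos \<theta> * v $ k + sin \<theta> * v $ l
     else if j = l then - sin \<theta> * v $ k + cos \<theta> * v $ l
     else v $ j)"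
| "apply_gate (Constant k c) v = vec (dim_vec v) (\<lambda>j. if j = k then c * v $ k else v $ j)"

type_synonym circuit = "gate list"

definition circuit_on :: "nat \<Rightarrow> circuit \<Rightarrow> bool" where
  "circuit_on n C \<longleftrightarrow> (\<forall>g \<in> set C. gate_on n g)"

text \<open>\<open>layer C v i\<close> is the layer \<open>L\<^sub>i\<close> on input \<open>L\<^sub>0 = v\<close>; gate \<open>i + 1\<close> of the circuit is \<open>C ! i\<close>.\<close>

fun layer :: "circuit \<Rightarrow> real vec \<Rightarrow> nat \<Rightarrow> real vec" where
  "layer C v 0 = v"
| "layer C v (Suc i) = apply_gate (C ! i) (layer C v i)"

definition defining_mat :: "nat \<Rightarrow> circuit \<Rightarrow> nat \<Rightarrow> real mat" where
  "defining_mat n C i = mat n n (\<lambda>(r, s). layer C (unit_vec n s) i $ r)"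

definition num_rotations :: "circuit \<Rightarrow> nat" where
  "num_rotations C = length (filter is_Rotation C)"

definition uniformly_well_conditioned :: "nat \<Rightarrow> real \<Rightarrow> circuit \<Rightarrow> bool" where
  "uniformly_well_conditioned n R C \<longleftrightarrow>
     (\<forall>i \<in> {1..length C}. condition_number (defining_mat n C i) \<le> R)"

lemma sum_unit_pair:
  fixes v :: "real vec"
  assumes "k < n" "l < n"
  shows "(\<Sum>s = 0..<n. (a * (if s = k then 1 else 0) + b * (if s = l then 1 else 0)) * v $ s)
    = a * v $ k + b * v $ l"
proof -
  have "(\<Sum>s = 0..<n. (a * (if s = k then 1 else 0) + b * (if s = l then 1 else 0)) * v $ s)
    = (\<Sum>s = 0..<n. (if s = k then a * v $ k else 0) + (if s = l then b * v $ l else 0))"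
    by (intro sum.cong) (auto simp: distrib_right)
  then show ?thesis
    using assms by (simp add: sum.distrib)
qed

definition gate_mat :: "nat \<Rightarrow> gate \<Rightarrow> real mat" where
  "gate_mat n g = mat n n (\<lambda>(r, s). apply_gate g (unit_vec n s) $ r)"

lemma gate_mat_carrier [simp]: "gate_mat n g \<in> carrier_mat n n"
  by (simp add: gate_mat_def)

lemma gate_mat_mult_vec:
  assumes g: "gate_on n g" and v: "v \<in> carrier_vec n"
  shows "gate_mat n g *\<^sub>v v = apply_gate g v"
proof (rule eq_vecI)
  show "dim_vec (gate_mat n g *\<^sub>v v) = dim_vec (apply_gate g v)"
    using v by (cases g) (auto simp: gate_mat_def)
next
  fix r assume "r < dim_vec (apply_gate g v)"
  then have r: "r < n" using v by (cases g) auto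
  have *: "(gate_mat n g *\<^sub>v v) $ r = (\<Sum>s = 0..<n. apply_gate g (unit_vec n s) $ r * v $ s)"
    using r v by (auto simp: gate_mat_def scalar_prod_def intro!: sum.cong)
  show "(gate_mat n g *\<^sub>v v) $ r = apply_gate g v $ r"
  proof (cases g)
    case (Rotation k l \<theta>)
    then have kl: "k < n" "l < n" "k < l" using g by auto
    have pair: "(gate_mat n g *\<^sub>v v) $ r = a * v $ p + b * v $ q"
      if pq: "p < n" "q < n"
        and ab: "\<And>s. s < n \<Longrightarrow> apply_gate g (unit_vec n s) $ r
          = a * (if s = p then 1 else 0) + b * (if s = q then 1 else 0)" for a b p q
      unfolding * sum_unit_pair[OF pq, of a b v, symmetric] using ab by (intro sum.cong) auto
    consider "r = k" | "r = l" "r \<noteq> k" | "r \<noteq> k" "r \<noteq> l" by blast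
    then show ?thesis
    proof cases
      case 1
      then show ?thesis
        using pair[of k l "cos \<theta>" "sin \<theta>"] kl v by (simp add: Rotation)
    next
      case 2
      then show ?thesis
        using pair[of k l "- sin \<theta>" "cos \<theta>"] kl v by (simp add: Rotation)
    next
      case 3
      then show ?thesis
        using pair[of r r 1 0] kl r v by (simp add: Rotation)
    qed
  next
    case (Constant k c)
    then have k: "k < n" using g by auto
    let ?a = "if r = k then c else 1"
    have "apply_gate g (unit_vec n s) $ r
        = ?a * (if s = r then 1 else 0) + 0 * (if s = r then 1 else 0)" if "s < n" for s
      using that k r Constant by (auto simp: unit_vec_def)
    then have "(gate_mat n g *\<^sub>v v) $ r = (\<Sum>s = 0..<n.
        (?a * (if s = r then 1 else 0) + 0 * (if s = r then 1 else 0)) * v $ s)"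
      unfolding * by (intro sum.cong) auto
    also have "\<dots> = ?a * v $ r + 0 * v $ r"
      using r by (intro sum_unit_pair) auto
    finally show ?thesis using Constant r v k by auto
  qed
qed

lemma layer_carrier:
  assumes "v \<in> carrier_vec n"
  shows "layer C v i \<in> carrier_vec n"
proof (induction i)
  case (Suc i)
  then show ?case by (cases "C ! i") auto
qed (use assms in simp)

lemma defining_mat_carrier [simp]: "defining_mat n C i \<in> carrier_mat n n"
  by (simp add: defining_mat_def)

lemma defining_mat_0: "defining_mat n C 0 = 1\<^sub>m n"
  by (rule eq_matI) (auto simp: defining_mat_def unit_vec_def)

lemma col_defining_mat: "s < n \<Longrightarrow> col (defining_mat n C i) s = layer C (unit_vec n s) i"
  using layer_carrier[of "unit_vec n s" n C i]
  by (intro eq_vecI) (auto simp: defining_mat_def)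

lemma defining_mat_Suc:
  assumes C: "circuit_on n C" and i: "i < length C"
  shows "defining_mat n C (Suc i) = gate_mat n (C ! i) * defining_mat n C i"
proof (rule mat_col_eqI)
  fix s assume "s < dim_col (gate_mat n (C ! i) * defining_mat n C i)"
  then have s: "s < n" by (simp add: defining_mat_def)
  have g: "gate_on n (C ! i)" using C i by (simp add: circuit_on_def)
  have "col (gate_mat n (C ! i) * defining_mat n C i) s
      = gate_mat n (C ! i) *\<^sub>v layer C (unit_vec n s) i"
    using s by (simp add: col_mult2[OF gate_mat_carrier defining_mat_carrier] col_defining_mat)
  also have "\<dots> = layer C (unit_vec n s) (Suc i)"
    using g by (simp add: gate_mat_mult_vec layer_carrier)
  finally show "col (defining_mat n C (Suc i)) s
      = col (gate_mat n (C ! i) * defining_mat n C i) s"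
    using s by (simp add: col_defining_mat)
qed (simp_all add: defining_mat_def gate_mat_def)

lemma defining_mat_mult_vec:
  assumes C: "circuit_on n C" and v: "v \<in> carrier_vec n"
  shows "i \<le> length C \<Longrightarrow> defining_mat n C i *\<^sub>v v = layer C v i"
proof (induction i)
  case 0
  then show ?case using v by (simp add: defining_mat_0)
next
  case (Suc i)
  then have "gate_on n (C ! i)" using C by (simp add: circuit_on_def)
  with Suc v show ?case
    by (simp add: defining_mat_Suc[OF C] gate_mat_mult_vec layer_carrier
        assoc_mult_mat_vec[OF gate_mat_carrier defining_mat_carrier v])
qed

fun inverse_gate :: "gate \<Rightarrow> gate" where
  "inverse_gate (Rotation k l \<theta>) = Rotation k l (- \<theta>)"
| "inverse_gate (Constant k c) = Constant k (1 / c)"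

lemma apply_inverse_gate:
  assumes "gate_on n g" and "v \<in> carrier_vec n"
  shows "apply_gate (inverse_gate g) (apply_gate g v) = v"
proof (cases g)
  case (Rotation k l \<theta>)
  have "a * (a * x + b * y) - b * (a * y - b * x) = (a * a + b * b) * x"
    and "b * (a * x + b * y) + a * (a * y - b * x) = (a * a + b * b) * y" for a b x y :: real
    by (simp_all add: algebra_simps)
  note rot = this[where a = "cos \<theta>" and b = "sin \<theta>"]
  have unit: "cos \<theta> * cos \<theta> + sin \<theta> * sin \<theta> = 1"
    using sin_cos_squared_add2[of \<theta>] by (simp only: power2_eq_square)
  show ?thesis
  proof (rule eq_vecI)
    fix j assume "j < dim_vec v"
    moreover have "k < dim_vec v" "l < dim_vec v" "k \<noteq> l"
      using assms Rotation by auto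
    ultimately show "apply_gate (inverse_gate g) (apply_gate g v) $ j = v $ j"
      by (simp add: Rotation rot unit)
  qed (simp add: Rotation)
next
  case (Constant k c)
  then show ?thesis using assms by (intro eq_vecI) auto
qed

lemma gate_mat_inverse:
  assumes g: "gate_on n g"
  shows "gate_mat n (inverse_gate g) * gate_mat n g = 1\<^sub>m n"
proof (rule mat_col_eqI)
  fix s assume "s < dim_col (1\<^sub>m n :: real mat)"
  then have s: "s < n" by simp
  have g': "gate_on n (inverse_gate g)" using g by (cases g) auto
  have u: "unit_vec n s \<in> carrier_vec n" by simp
  have w: "apply_gate g (unit_vec n s) \<in> carrier_vec n" by (cases g) auto
  have "col (gate_mat n g) s = apply_gate g (unit_vec n s)"
    using s w by (intro eq_vecI) (auto simp: gate_mat_def)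
  then show "col (gate_mat n (inverse_gate g) * gate_mat n g) s = col (1\<^sub>m n) s"
    using s by (simp add: col_mult2[OF gate_mat_carrier gate_mat_carrier]
        gate_mat_mult_vec[OF g' w] apply_inverse_gate[OF g u])
qed (simp_all add: gate_mat_def)

lemma defining_mat_left_inverse:
  assumes C: "circuit_on n C"
  shows "i \<le> length C \<Longrightarrow> \<exists>B \<in> carrier_mat n n. B * defining_mat n C i = 1\<^sub>m n"
proof (induction i)
  case 0
  show ?case by (intro bexI[of _ "1\<^sub>m n"]) (auto simp: defining_mat_0)
next
  case (Suc i)
  then obtain B where B: "B \<in> carrier_mat n n" "B * defining_mat n C i = 1\<^sub>m n" by auto
  let ?G = "gate_mat n (C ! i)" and ?H = "gate_mat n (inverse_gate (C ! i))"
  have g: "gate_on n (C ! i)" using C Suc.prems by (simp add: circuit_on_def)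
  have "(B * ?H) * defining_mat n C (Suc i) = (B * ?H) * (?G * defining_mat n C i)"
    using Suc.prems by (simp add: defining_mat_Suc[OF C])
  also have "\<dots> = B * (?H * (?G * defining_mat n C i))"
    by (rule assoc_mult_mat[OF B(1) gate_mat_carrier mult_carrier_mat[OF gate_mat_carrier defining_mat_carrier]])
  also have "?H * (?G * defining_mat n C i) = (?H * ?G) * defining_mat n C i"
    by (rule assoc_mult_mat[OF gate_mat_carrier gate_mat_carrier defining_mat_carrier, symmetric])
  also have "\<dots> = defining_mat n C i"
    by (simp add: gate_mat_inverse[OF g] left_mult_one_mat[OF defining_mat_carrier])
  finally show ?case
    using B by (intro bexI[of _ "B * ?H"] mult_carrier_mat[OF B(1) gate_mat_carrier]) simp
qed

lemma mat_inverse_defining_mat: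
  assumes "circuit_on n C" and "i \<le> length C"
  obtains B where "mat_inverse (defining_mat n C i) = Some B" and "B \<in> carrier_mat n n"
    and "defining_mat n C i * B = 1\<^sub>m n" and "B * defining_mat n C i = 1\<^sub>m n"
proof -
  let ?M = "defining_mat n C i"
  obtain A where A: "A \<in> carrier_mat n n" "A * ?M = 1\<^sub>m n"
    using defining_mat_left_inverse[OF assms] by auto
  have "?M * A = 1\<^sub>m n"
    by (rule mat_mult_left_right_inverse[OF A(1) defining_mat_carrier A(2)])
  with A have "?M \<in> Units (ring_mat TYPE(real) n ())"
    unfolding Units_def ring_mat_def by simp blast
  then obtain B where B: "mat_inverse ?M = Some B"
    using mat_inverse(1)[OF defining_mat_carrier, of n C i "()"]
    by (cases "mat_inverse ?M") simp_all
  show ?thesis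
    using that[OF B] mat_inverse(2)[OF defining_mat_carrier B] by simp
qed

end

theory Submission
  imports Defs "HOL-Analysis.L2_Norm"
begin

text \<open>The potential of a circuit after gate \<open>i\<close> is the quasi-entropy
  \<open>- \<Sum> p ln \<bar>p\<bar>\<close> of the numbers \<open>p = M\<^sub>i(r, s) * M\<^sub>i\<inverse>(s, r)\<close>. It vanishes for the identity
  and is not affected by constant gates, which scale a row of \<open>M\<^sub>i\<close> and the corresponding column
  of \<open>M\<^sub>i\<inverse>\<close> by inverse factors. A rotation acts orthogonally on two rows of \<open>M\<^sub>i\<close> and on two
  columns of \<open>M\<^sub>i\<inverse>\<close>; it changes the potential by at most four times the sum over \<open>s\<close> of the
  products of the lengths of the two planar vectors involved, which by Cauchy-Schwarz is at most
  \<open>8 \<parallel>M\<^sub>i\<parallel> \<parallel>M\<^sub>i\<inverse>\<parallel> \<le> 8 R\<close>. For a multiple of an orthogonal matrix \<open>F\<close> with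
  \<open>F(r, s)\<^sup>2 \<le> 2/n\<close> the potential is an ordinary entropy, at least \<open>n ln (n/2)\<close>.\<close>

section \<open>The spectral norm\<close>

lemma euclidean_norm_sum:
  assumes "v \<in> carrier_vec n"
  shows "euclidean_norm v = L2_set (\<lambda>i. v $ i) {..<n}"
  using assms
  by (simp add: euclidean_norm_def L2_set_def scalar_prod_def power2_eq_square atLeast0LessThan)

lemma abs_vec_index_le_euclidean_norm:
  assumes "v \<in> carrier_vec n" "i < n"
  shows "\<bar>v $ i\<bar> \<le> euclidean_norm v"
proof -
  have "(v $ i)\<^sup>2 \<le> (\<Sum>i<n. (v $ i)\<^sup>2)"
    using assms(2) by (intro member_le_sum) auto
  then show ?thesis
    unfolding euclidean_norm_sum[OF assms(1)] L2_set_def by (simp add: real_le_rsqrt)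
qed

lemma euclidean_norm_nonneg [simp]: "0 \<le> euclidean_norm v"
  by (simp add: euclidean_norm_def scalar_prod_def sum_nonneg)

lemma euclidean_norm_smult: "euclidean_norm (c \<cdot>\<^sub>v v) = \<bar>c\<bar> * euclidean_norm v"
proof -
  have "(c \<cdot>\<^sub>v v) \<bullet> (c \<cdot>\<^sub>v v) = c\<^sup>2 * (v \<bullet> v)"
    by (simp add: scalar_prod_def sum_distrib_left power2_eq_square mult_ac)
  then show ?thesis
    by (simp add: euclidean_norm_def real_sqrt_mult)
qed

lemma euclidean_norm_eq_0D:
  assumes "v \<in> carrier_vec n" "euclidean_norm v = 0"
  shows "v = 0\<^sub>v n"
proof (rule eq_vecI)
  fix i assume "i < dim_vec (0\<^sub>v n :: real vec)"
  with abs_vec_index_le_euclidean_norm[OF assms(1), of i] assms(2)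
  show "v $ i = 0\<^sub>v n $ i" by simp
qed (use assms in simp)

lemma abs_mult_mat_vec_index_le:
  assumes "i < dim_row A" "v \<in> carrier_vec (dim_col A)" "euclidean_norm v \<le> 1"
  shows "\<bar>(A *\<^sub>v v) $ i\<bar> \<le> (\<Sum>j<dim_col A. \<bar>A $$ (i, j)\<bar>)"
proof -
  have "\<bar>(A *\<^sub>v v) $ i\<bar> = \<bar>\<Sum>j<dim_col A. A $$ (i, j) * v $ j\<bar>"
    using assms(1,2) by (simp add: scalar_prod_def atLeast0LessThan)
  also have "\<dots> \<le> (\<Sum>j<dim_col A. \<bar>A $$ (i, j)\<bar>)"
  proof (rule order_trans[OF sum_abs sum_mono])
    fix j assume "j \<in> {..<dim_col A}"
    then have "\<bar>v $ j\<bar> \<le> 1"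
      using assms(3) abs_vec_index_le_euclidean_norm[OF assms(2), of j] by simp
    then show "\<bar>A $$ (i, j) * v $ j\<bar> \<le> \<bar>A $$ (i, j)\<bar>"
      by (simp add: abs_mult mult_left_le)
  qed
  finally show ?thesis .
qed

text \<open>A supremum of reals bounds its set only if that set is bounded above. The sum of all
  absolute entries is a crude bound that suffices.\<close>

lemma bdd_above_spectral_norm:
  "bdd_above ((\<lambda>v. euclidean_norm (A *\<^sub>v v)) `
     {v \<in> carrier_vec (dim_col A). euclidean_norm v \<le> 1})"
proof (rule bdd_aboveI2)
  fix v assume v: "v \<in> {v \<in> carrier_vec (dim_col A). euclidean_norm v \<le> 1}"
  have "euclidean_norm (A *\<^sub>v v) = L2_set (\<lambda>i. (A *\<^sub>v v) $ i) {..<dim_row A}"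
    by (intro euclidean_norm_sum carrier_vecI) simp
  also have "\<dots> \<le> (\<Sum>i<dim_row A. \<bar>(A *\<^sub>v v) $ i\<bar>)" by (rule L2_set_le_sum_abs)
  also have "\<dots> \<le> (\<Sum>i<dim_row A. \<Sum>j<dim_col A. \<bar>A $$ (i, j)\<bar>)"
    using v by (intro sum_mono abs_mult_mat_vec_index_le) auto
  finally show "euclidean_norm (A *\<^sub>v v) \<le> (\<Sum>i<dim_row A. \<Sum>j<dim_col A. \<bar>A $$ (i, j)\<bar>)" .
qed

lemma spectral_norm_nonneg: "0 \<le> spectral_norm A"
proof -
  have "euclidean_norm (A *\<^sub>v 0\<^sub>v (dim_col A)) \<le> spectral_norm A"
    unfolding spectral_norm_def
    by (intro cSUP_upper bdd_above_spectral_norm) (simp add: euclidean_norm_def)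
  then show ?thesis using euclidean_norm_nonneg order_trans by blast
qed

lemma euclidean_norm_mult_mat_vec:
  assumes v: "v \<in> carrier_vec (dim_col A)"
  shows "euclidean_norm (A *\<^sub>v v) \<le> spectral_norm A * euclidean_norm v"
proof (cases "euclidean_norm v = 0")
  case True
  then have "v = 0\<^sub>v (dim_col A)" using euclidean_norm_eq_0D v by blast
  then have "A *\<^sub>v v = 0\<^sub>v (dim_row A)" by (auto simp: scalar_prod_def)
  then show ?thesis using True by (simp add: euclidean_norm_def)
next
  case False
  then have pos: "euclidean_norm v > 0" using euclidean_norm_nonneg[of v] by linarith
  let ?c = "1 / euclidean_norm v"
  have "euclidean_norm (A *\<^sub>v (?c \<cdot>\<^sub>v v)) \<le> spectral_norm A"
    unfolding spectral_norm_def using v pos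
    by (intro cSUP_upper bdd_above_spectral_norm) (auto simp: euclidean_norm_smult)
  moreover have "A *\<^sub>v (?c \<cdot>\<^sub>v v) = ?c \<cdot>\<^sub>v (A *\<^sub>v v)"
    using v by (intro mult_mat_vec) auto
  ultimately have "?c * euclidean_norm (A *\<^sub>v v) \<le> spectral_norm A"
    using pos by (simp add: euclidean_norm_smult)
  then show ?thesis using pos by (simp add: field_simps)
qed

lemma sum_col_squares_le_spectral_norm:
  assumes B: "B \<in> carrier_mat m n" and k: "k < n"
  shows "(\<Sum>j<m. (B $$ (j, k))\<^sup>2) \<le> (spectral_norm B)\<^sup>2"
proof -
  have "B *\<^sub>v unit_vec n k = col B k"
    using B k by (auto simp: scalar_prod_def unit_vec_def if_distrib cong: if_cong)
  then have "euclidean_norm (col B k) \<le> spectral_norm B"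
    using euclidean_norm_mult_mat_vec[of "unit_vec n k" B] B k
    by (simp add: euclidean_norm_def)
  then have "(euclidean_norm (col B k))\<^sup>2 \<le> (spectral_norm B)\<^sup>2"
    by (intro power_mono) auto
  then show ?thesis
    using B k by (simp add: euclidean_norm_sum[of _ m] L2_set_def sum_nonneg)
qed

text \<open>Feeding row \<open>k\<close> to \<open>A\<close> itself makes coordinate
  \<open>k\<close> of the image the squared length \<open>s\<close> of that row, so
  \<open>s \<le> spectral_norm A * sqrt s\<close>. This avoids the norm of the transpose.\<close>

lemma sum_row_squares_le_spectral_norm:
  assumes A: "A \<in> carrier_mat m n" and k: "k < m"
  shows "(\<Sum>j<n. (A $$ (k, j))\<^sup>2) \<le> (spectral_norm A)\<^sup>2"
proof -
  let ?s = "\<Sum>j<n. (A $$ (k, j))\<^sup>2"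
  have nrm: "euclidean_norm (row A k) = sqrt ?s"
    using A k by (simp add: euclidean_norm_sum[of _ n] L2_set_def)
  have s: "0 \<le> ?s" by (simp add: sum_nonneg)
  have "?s = (A *\<^sub>v row A k) $ k"
    using A k by (simp add: scalar_prod_def power2_eq_square atLeast0LessThan)
  also have "\<dots> \<le> euclidean_norm (A *\<^sub>v row A k)"
    using abs_vec_index_le_euclidean_norm[of "A *\<^sub>v row A k" m k] A k by auto
  also have "\<dots> \<le> spectral_norm A * sqrt ?s"
    using euclidean_norm_mult_mat_vec[of "row A k" A] A k by (simp add: nrm)
  finally have "sqrt ?s * sqrt ?s \<le> spectral_norm A * sqrt ?s" using s by simp
  then have "sqrt ?s \<le> spectral_norm A"
    using s spectral_norm_nonneg[of A]
    by (cases "?s = 0") (auto simp del: real_sqrt_mult_self dest: mult_right_le_imp_le)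
  then show ?thesis using s spectral_norm_nonneg[of A] sqrt_le_D by blast
qed

section \<open>The quasi-entropy potential\<close>

text \<open>The absolute value extends the entropy function oddly to negative arguments. The natural
  logarithm suits the bound \<open>ln t \<le> t - 1\<close>; base 2 returns only in the final
  constant.\<close>

definition entropy_term :: "real \<Rightarrow> real" where
  "entropy_term x = - x * ln \<bar>x\<bar>"

text \<open>Intended for \<open>B = A\<inverse>\<close>: then the numbers \<open>A\<^sub>i\<^sub>j B\<^sub>j\<^sub>i\<close> sum to 1 in every row and column,
  but they may be negative.\<close>

definition quasi_entropy :: "nat \<Rightarrow> real mat \<Rightarrow> real mat \<Rightarrow> real" where
  "quasi_entropy n A B = (\<Sum>i<n. \<Sum>j<n. entropy_term (A $$ (i, j) * B $$ (j, i)))"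

text \<open>For \<open>x \<noteq> 0\<close> the expression is
  \<open>x * ln (r / \<bar>x\<bar>)\<close>, and \<open>ln t \<le> t - 1\<close> bounds its absolute
  value by \<open>r - \<bar>x\<bar>\<close>.\<close>

lemma abs_entropy_term_shift:
  assumes "\<bar>x\<bar> \<le> r"
  shows "\<bar>entropy_term x + x * ln r\<bar> \<le> r"
proof (cases "x = 0")
  case True
  then show ?thesis using assms by (simp add: entropy_term_def)
next
  case False
  then have x: "0 < \<bar>x\<bar>" and r: "0 < r" using assms by auto
  have "entropy_term x + x * ln r = x * ln (r / \<bar>x\<bar>)"
    using x r by (simp add: entropy_term_def ln_div algebra_simps)
  moreover have "0 \<le> ln (r / \<bar>x\<bar>)" using assms x by simp
  moreover have "ln (r / \<bar>x\<bar>) \<le> r / \<bar>x\<bar> - 1" using x r by (intro ln_le_minus_one) simp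
  ultimately have "\<bar>entropy_term x + x * ln r\<bar> \<le> \<bar>x\<bar> * (r / \<bar>x\<bar> - 1)"
    by (simp add: abs_mult mult_left_mono)
  also have "\<dots> \<le> r" using x by (simp add: algebra_simps)
  finally show ?thesis .
qed

text \<open>Since the sums agree, the scale \<open>r\<close> enters the difference only as a factor,
  not through \<open>ln r\<close>.\<close>

lemma entropy_term_pair_diff:
  assumes "x + y = x' + y'" "\<bar>x\<bar> \<le> r" "\<bar>y\<bar> \<le> r" "\<bar>x'\<bar> \<le> r" "\<bar>y'\<bar> \<le> r"
  shows "\<bar>(entropy_term x + entropy_term y) - (entropy_term x' + entropy_term y')\<bar> \<le> 4 * r"
proof -
  have "x * ln r + y * ln r = x' * ln r + y' * ln r"
    using assms(1) by (metis distrib_right)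
  then show ?thesis
    using assms(2-)[THEN abs_entropy_term_shift] by linarith
qed

lemma abs_mult_le_sqrt_mult:
  fixes a b c d :: real
  assumes "a\<^sup>2 \<le> c" "b\<^sup>2 \<le> d"
  shows "\<bar>a * b\<bar> \<le> sqrt c * sqrt d"
proof -
  have "0 \<le> c" using order_trans[OF zero_le_power2 assms(1)] .
  then show ?thesis
    unfolding abs_mult using assms by (intro mult_mono real_le_rsqrt) simp_all
qed

text \<open>The rotation takes \<open>(a, b)\<close> to \<open>(a', b')\<close> and
  \<open>(p', q')\<close> to \<open>(p, q)\<close>. Hence
  \<open>a' * p + b' * q = a * p' + b * q'\<close>, and as lengths are preserved, one product of
  lengths bounds all four products.\<close>

lemma rotation_entropy_term_diff:
  fixes c s a b p q :: real
  assumes unit: "c\<^sup>2 + s\<^sup>2 = 1"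
  defines "a' \<equiv> c * a + s * b" and "b' \<equiv> - s * a + c * b"
    and "p' \<equiv> c * p - s * q" and "q' \<equiv> s * p + c * q"
  shows "\<bar>(entropy_term (a' * p) + entropy_term (b' * q))
      - (entropy_term (a * p') + entropy_term (b * q'))\<bar>
    \<le> 4 * (sqrt (a'\<^sup>2 + b'\<^sup>2) * sqrt (p\<^sup>2 + q\<^sup>2))"
proof -
  have "a'\<^sup>2 + b'\<^sup>2 = (c\<^sup>2 + s\<^sup>2) * (a\<^sup>2 + b\<^sup>2)" "p'\<^sup>2 + q'\<^sup>2 = (c\<^sup>2 + s\<^sup>2) * (p\<^sup>2 + q\<^sup>2)"
    by (simp_all add: a'_def b'_def p'_def q'_def power2_eq_square algebra_simps)
  then have "a'\<^sup>2 + b'\<^sup>2 = a\<^sup>2 + b\<^sup>2" "p'\<^sup>2 + q'\<^sup>2 = p\<^sup>2 + q\<^sup>2" using unit by simp_all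
  then have "a\<^sup>2 \<le> a'\<^sup>2 + b'\<^sup>2" "b\<^sup>2 \<le> a'\<^sup>2 + b'\<^sup>2" "p'\<^sup>2 \<le> p\<^sup>2 + q\<^sup>2" "q'\<^sup>2 \<le> p\<^sup>2 + q\<^sup>2"
    using zero_le_power2[of a] zero_le_power2[of b] zero_le_power2[of p'] zero_le_power2[of q']
    by linarith+
  then show ?thesis
    by (intro entropy_term_pair_diff abs_mult_le_sqrt_mult)
       (simp_all add: a'_def b'_def p'_def q'_def algebra_simps)
qed

section \<open>The effect of one gate on the potential\<close>

lemma index_gate_mat_mult:
  assumes "gate_on n g" "M \<in> carrier_mat n n" "i < n" "j < n"
  shows "(gate_mat n g * M) $$ (i, j) = apply_gate g (col M j) $ i"
proof -
  have "(gate_mat n g * M) $$ (i, j) = (gate_mat n g *\<^sub>v col M j) $ i"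
    using assms(2-) by (simp add: gate_mat_def)
  then show ?thesis using assms by (simp add: gate_mat_mult_vec)
qed

lemma index_mult_gate_mat:
  assumes "B \<in> carrier_mat n n" "i < n" "j < n"
  shows "(B * gate_mat n g) $$ (j, i) = (\<Sum>s<n. B $$ (j, s) * apply_gate g (unit_vec n i) $ s)"
  using assms by (auto simp: gate_mat_def scalar_prod_def atLeast0LessThan intro!: sum.cong)

text \<open>If \<open>B\<close> inverts the matrix after the gate, then \<open>B\<close> times the
  gate inverts the matrix before it. The factor \<open>c\<close> only moves from row
  \<open>k\<close> of one matrix to column \<open>k\<close> of the other, so every product of
  entries stays the same.\<close>

lemma quasi_entropy_constant:
  assumes g: "gate_on n (Constant k c)" and M: "M \<in> carrier_mat n n" and B: "B \<in> carrier_mat n n"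
  shows "quasi_entropy n (gate_mat n (Constant k c) * M) B
    = quasi_entropy n M (B * gate_mat n (Constant k c))"
proof -
  have "(gate_mat n (Constant k c) * M) $$ (i, j) * B $$ (j, i)
      = M $$ (i, j) * (B * gate_mat n (Constant k c)) $$ (j, i)" if "i < n" "j < n" for i j
  proof -
    have "(B * gate_mat n (Constant k c)) $$ (j, i)
        = (\<Sum>s<n. if s = i then (if i = k then c else 1) * B $$ (j, i) else 0)"
      unfolding index_mult_gate_mat[OF B that] using g that
      by (intro sum.cong) (auto simp: unit_vec_def)
    then show ?thesis using that g M
      by (simp add: index_gate_mat_mult[OF g M that])
  qed
  then show ?thesis unfolding quasi_entropy_def
    by (intro sum.cong refl) simp
qed

lemma sum_remove_two:
  fixes f :: "nat \<Rightarrow> 'a::comm_monoid_add"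
  assumes "k < l" "l < n"
  shows "(\<Sum>i<n. f i) = (f k + f l) + (\<Sum>i\<in>{..<n} - {k, l}. f i)"
proof -
  have "(\<Sum>i<n. f i) = f k + (\<Sum>i\<in>{..<n} - {k}. f i)"
    using assms by (intro sum.remove) auto
  also have "(\<Sum>i\<in>{..<n} - {k}. f i) = f l + (\<Sum>i\<in>{..<n} - {k} - {l}. f i)"
    using assms by (intro sum.remove) auto
  also have "{..<n} - {k} - {l} = {..<n} - {k, l}" by auto
  finally show ?thesis by (simp add: add.assoc)
qed

text \<open>In the application \<open>M'\<close> and \<open>B\<close> are the matrix after the gate
  and its inverse; \<open>M\<close> and \<open>B * gate_mat n (Rotation k l \<theta>)\<close> are
  those before it. The planar estimate is summed over \<open>j\<close> by Cauchy-Schwarz.\<close>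

lemma quasi_entropy_rotation:
  assumes g: "gate_on n (Rotation k l \<theta>)" and M: "M \<in> carrier_mat n n"
    and B: "B \<in> carrier_mat n n"
  defines "M' \<equiv> gate_mat n (Rotation k l \<theta>) * M"
  shows "\<bar>quasi_entropy n M' B - quasi_entropy n M (B * gate_mat n (Rotation k l \<theta>))\<bar>
    \<le> 8 * (spectral_norm M' * spectral_norm B)"
proof -
  define B' where "B' = B * gate_mat n (Rotation k l \<theta>)"
  have kl: "k < l" "l < n" "k < n" using g by auto
  have M': "M' \<in> carrier_mat n n"
    unfolding M'_def by (rule mult_carrier_mat[OF gate_mat_carrier M])
  have idx: "M' $$ (i, j) = (if i = k then cos \<theta> * M $$ (k, j) + sin \<theta> * M $$ (l, j)
      else if i = l then - sin \<theta> * M $$ (k, j) + cos \<theta> * M $$ (l, j) else M $$ (i, j))"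
    if "i < n" "j < n" for i j
    using that kl M by (simp add: M'_def index_gate_mat_mult[OF g M that])
  have Bk: "B' $$ (j, k) = cos \<theta> * B $$ (j, k) - sin \<theta> * B $$ (j, l)" if "j < n" for j
  proof -
    have "B' $$ (j, k) = (\<Sum>s = 0..<n. (cos \<theta> * (if s = k then 1 else 0)
        + (- sin \<theta>) * (if s = l then 1 else 0)) * row B j $ s)"
      unfolding B'_def index_mult_gate_mat[OF B \<open>k < n\<close> that] atLeast0LessThan
      using kl that B by (intro sum.cong) (auto simp: unit_vec_def)
    then show ?thesis
      using that kl B by (simp only: sum_unit_pair[OF \<open>k < n\<close> \<open>l < n\<close>]) simp
  qed
  have Bl: "B' $$ (j, l) = sin \<theta> * B $$ (j, k) + cos \<theta> * B $$ (j, l)" if "j < n" for j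
  proof -
    have "B' $$ (j, l) = (\<Sum>s = 0..<n. (sin \<theta> * (if s = k then 1 else 0)
        + cos \<theta> * (if s = l then 1 else 0)) * row B j $ s)"
      unfolding B'_def index_mult_gate_mat[OF B \<open>l < n\<close> that] atLeast0LessThan
      using kl that B by (intro sum.cong) (auto simp: unit_vec_def)
    then show ?thesis
      using that kl B by (simp only: sum_unit_pair[OF \<open>k < n\<close> \<open>l < n\<close>]) simp
  qed
  have Bi: "B' $$ (j, i) = B $$ (j, i)" if "j < n" "i < n" "i \<noteq> k" "i \<noteq> l" for i j
  proof -
    have "B' $$ (j, i) = (\<Sum>s<n. if s = i then B $$ (j, i) else 0)"
      unfolding B'_def index_mult_gate_mat[OF B that(2,1)]
      using that kl by (intro sum.cong) (auto simp: unit_vec_def)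
    then show ?thesis using that by simp
  qed
  let ?e = "\<lambda>A B i j. entropy_term (A $$ (i, j) * B $$ (j, i))"
  \<comment> \<open>All rows other than \<open>k\<close> and \<open>l\<close> contribute equally to
    both potentials and cancel.\<close>
  have diff: "quasi_entropy n M' B - quasi_entropy n M B'
      = (\<Sum>j<n. (?e M' B k j + ?e M' B l j) - (?e M B' k j + ?e M B' l j))"
  proof -
    have "(\<Sum>i\<in>{..<n} - {k, l}. \<Sum>j<n. ?e M' B i j) = (\<Sum>i\<in>{..<n} - {k, l}. \<Sum>j<n. ?e M B' i j)"
      by (intro sum.cong refl) (auto simp: idx Bi)
    then show ?thesis
      unfolding quasi_entropy_def sum_remove_two[OF kl(1,2)]
      by (simp add: sum.distrib sum_subtractf)
  qed
  have "\<bar>quasi_entropy n M' B - quasi_entropy n M B'\<bar> \<le> (\<Sum>j<n. 4 * (sqrt ((M' $$ (k, j))\<^sup>2 + (M' $$ (l, j))\<^sup>2)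
      * sqrt ((B $$ (j, k))\<^sup>2 + (B $$ (j, l))\<^sup>2)))"
    unfolding diff
  proof (rule order_trans[OF sum_abs sum_mono])
    fix j assume "j \<in> {..<n}"
    then show "\<bar>(?e M' B k j + ?e M' B l j) - (?e M B' k j + ?e M B' l j)\<bar>
        \<le> 4 * (sqrt ((M' $$ (k, j))\<^sup>2 + (M' $$ (l, j))\<^sup>2)
          * sqrt ((B $$ (j, k))\<^sup>2 + (B $$ (j, l))\<^sup>2))"
      using rotation_entropy_term_diff[of "cos \<theta>" "sin \<theta>" "M $$ (k, j)" "M $$ (l, j)"
          "B $$ (j, k)" "B $$ (j, l)"] kl
      by (simp add: idx Bk Bl)
  qed
  also have "\<dots> = 4 * (\<Sum>j<n. \<bar>sqrt ((M' $$ (k, j))\<^sup>2 + (M' $$ (l, j))\<^sup>2)\<bar>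
      * \<bar>sqrt ((B $$ (j, k))\<^sup>2 + (B $$ (j, l))\<^sup>2)\<bar>)"
    unfolding sum_distrib_left by (intro sum.cong refl) simp
  also have "\<dots> \<le> 4 * (L2_set (\<lambda>j. sqrt ((M' $$ (k, j))\<^sup>2 + (M' $$ (l, j))\<^sup>2)) {..<n}
      * L2_set (\<lambda>j. sqrt ((B $$ (j, k))\<^sup>2 + (B $$ (j, l))\<^sup>2)) {..<n})"
    by (intro mult_left_mono L2_set_mult_ineq) simp
  \<comment> \<open>Two rows, respectively two columns, put a factor 2 under each root; this raises
    the constant from 4 to 8.\<close>
  also have "\<dots> \<le> 4 * (sqrt (2 * (spectral_norm M')\<^sup>2) * sqrt (2 * (spectral_norm B)\<^sup>2))"
  proof (intro mult_left_mono mult_mono)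
    show "L2_set (\<lambda>j. sqrt ((M' $$ (k, j))\<^sup>2 + (M' $$ (l, j))\<^sup>2)) {..<n}
        \<le> sqrt (2 * (spectral_norm M')\<^sup>2)"
      using sum_row_squares_le_spectral_norm[OF M', of k]
        sum_row_squares_le_spectral_norm[OF M', of l] kl
      by (simp add: L2_set_def sum.distrib)
    show "L2_set (\<lambda>j. sqrt ((B $$ (j, k))\<^sup>2 + (B $$ (j, l))\<^sup>2)) {..<n}
        \<le> sqrt (2 * (spectral_norm B)\<^sup>2)"
      using sum_col_squares_le_spectral_norm[OF B, of k]
        sum_col_squares_le_spectral_norm[OF B, of l] kl
      by (simp add: L2_set_def sum.distrib)
  qed (auto simp: L2_set_nonneg)
  also have "\<dots> = 8 * (spectral_norm M' * spectral_norm B)"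
    using spectral_norm_nonneg[of M'] spectral_norm_nonneg[of B]
    by (simp add: real_sqrt_mult)
  finally show ?thesis by (simp add: B'_def)
qed

text \<open>Induction on the prefix: a rotation costs at most \<open>8 * R\<close>, a constant gate
  nothing. The condition number used is that of the layer after the gate, with index
  \<open>Suc m\<close>.\<close>

lemma quasi_entropy_defining_mat_le:
  assumes C: "circuit_on n C" and W: "uniformly_well_conditioned n R C"
  shows "m \<le> length C \<Longrightarrow>
    quasi_entropy n (defining_mat n C m) (the (mat_inverse (defining_mat n C m)))
      \<le> 8 * R * real (length (filter is_Rotation (take m C)))"
proof (induction m)
  case 0
  obtain B where B: "mat_inverse (defining_mat n C 0) = Some B" "B \<in> carrier_mat n n"
    "B * defining_mat n C 0 = 1\<^sub>m n"
    by (rule mat_inverse_defining_mat[OF C 0])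
  \<comment> \<open>The products of entries are 0 or 1, and \<open>entropy_term\<close> vanishes at
    both, so the potential starts at 0.\<close>
  then have "mat_inverse (1\<^sub>m n :: real mat) = Some (1\<^sub>m n)" by (simp add: defining_mat_0)
  then show ?case
    by (simp add: defining_mat_0 quasi_entropy_def entropy_term_def if_distrib cong: if_cong)
next
  case (Suc m)
  let ?M = "defining_mat n C m" and ?M' = "defining_mat n C (Suc m)" and ?g = "C ! m"
  have m: "m < length C" "m \<le> length C" using Suc.prems by auto
  obtain B where B: "mat_inverse ?M = Some B" "B \<in> carrier_mat n n" "?M * B = 1\<^sub>m n"
    by (rule mat_inverse_defining_mat[OF C m(2)])
  obtain B' where B': "mat_inverse ?M' = Some B'" "B' \<in> carrier_mat n n" "B' * ?M' = 1\<^sub>m n"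
    by (rule mat_inverse_defining_mat[OF C Suc.prems])
  have g: "gate_on n ?g" using C m by (simp add: circuit_on_def)
  have M': "?M' = gate_mat n ?g * ?M" by (rule defining_mat_Suc[OF C m(1)])
  have BG: "B' * gate_mat n ?g \<in> carrier_mat n n"
    by (rule mult_carrier_mat[OF B'(2) gate_mat_carrier])
  have "B' * gate_mat n ?g * ?M = 1\<^sub>m n"
    using B'(3) unfolding M'
    by (simp add: assoc_mult_mat[OF B'(2) gate_mat_carrier defining_mat_carrier])
  \<comment> \<open>A left inverse and a right inverse of \<open>?M\<close> coincide.\<close>
  then have "B = B' * gate_mat n ?g"
    using assoc_mult_mat[OF BG defining_mat_carrier[of n C m] B(2)] B(3)
      left_mult_one_mat[OF B(2)] right_mult_one_mat[OF BG] by simp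
  then have IH: "quasi_entropy n ?M (B' * gate_mat n ?g)
      \<le> 8 * R * real (length (filter is_Rotation (take m C)))"
    using Suc.IH m B(1) by simp
  have R: "spectral_norm ?M' * spectral_norm B' \<le> R"
    using W Suc.prems B'(1)
    by (auto simp: uniformly_well_conditioned_def condition_number_def dest: bspec[of _ _ "Suc m"])
  have "quasi_entropy n ?M' B' \<le> quasi_entropy n ?M (B' * gate_mat n ?g)
      + (if is_Rotation ?g then 8 * R else 0)"
  proof (cases ?g)
    case (Rotation k l \<theta>)
    then show ?thesis
      using quasi_entropy_rotation[of n k l \<theta> ?M B'] g B'(2) R M' by simp
  next
    case (Constant k c)
    then show ?thesis
      using quasi_entropy_constant[of n k c ?M B'] g B'(2) M' by simp
  qed
  with IH show ?case
    using m B'(1) by (cases "is_Rotation ?g") (simp_all add: take_Suc_conv_app_nth distrib_left)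
qed

text \<open>The inverse of \<open>a \<cdot>\<^sub>m F\<close> is the transpose of \<open>F\<close>
  divided by \<open>a\<close>, so the scalar cancels and the products are the squared entries of
  \<open>F\<close>. These have total \<open>n\<close>, and \<open>- ln\<close> of each nonzero one
  is at least \<open>ln (1 / b)\<close>.\<close>

lemma quasi_entropy_orthogonal_ge:
  assumes F: "F \<in> carrier_mat n n" and a: "a \<noteq> 0"
    and orth: "transpose_mat F * F = 1\<^sub>m n"
    and B: "B \<in> carrier_mat n n" "(a \<cdot>\<^sub>m F) * B = 1\<^sub>m n"
    and b: "0 < b" "\<And>i j. i < n \<Longrightarrow> j < n \<Longrightarrow> (F $$ (i, j))\<^sup>2 \<le> b"
  shows "real n * ln (1 / b) \<le> quasi_entropy n (a \<cdot>\<^sub>m F) B"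
proof -
  have FT: "transpose_mat F \<in> carrier_mat n n" using F by simp
  have FB: "F * (a \<cdot>\<^sub>m B) = 1\<^sub>m n"
    using B(2) by (simp add: mult_smult_assoc_mat[OF F B(1)] mult_smult_distrib[OF F B(1)])
  have "transpose_mat F = transpose_mat F * (F * (a \<cdot>\<^sub>m B))" using FT FB by simp
  also have "\<dots> = a \<cdot>\<^sub>m B"
    using assoc_mult_mat[OF FT F smult_carrier_mat[OF B(1), of a]] orth B by simp
  finally have T: "F $$ (i, j) = a * B $$ (j, i)" if "i < n" "j < n" for i j
    using that F B by (metis carrier_matD index_smult_mat(1) index_transpose_mat(1))
  have "quasi_entropy n (a \<cdot>\<^sub>m F) B = (\<Sum>i<n. \<Sum>j<n. entropy_term ((F $$ (i, j))\<^sup>2))"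
    unfolding quasi_entropy_def
  proof (intro sum.cong refl)
    fix i j assume "i \<in> {..<n}" "j \<in> {..<n}"
    then have ij: "i < n" "j < n" by auto
    have "(a \<cdot>\<^sub>m F) $$ (i, j) * B $$ (j, i) = F $$ (i, j) * (a * B $$ (j, i))"
      using F ij by simp
    then show "entropy_term ((a \<cdot>\<^sub>m F) $$ (i, j) * B $$ (j, i)) = entropy_term ((F $$ (i, j))\<^sup>2)"
      by (simp only: T[OF ij, symmetric] power2_eq_square)
  qed
  also have "\<dots> \<ge> (\<Sum>i<n. \<Sum>j<n. (F $$ (i, j))\<^sup>2 * ln (1 / b))"
  proof (intro sum_mono)
    fix i j assume "i \<in> {..<n}" "j \<in> {..<n}"
    then have le: "(F $$ (i, j))\<^sup>2 \<le> b" using b by simp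
    show "(F $$ (i, j))\<^sup>2 * ln (1 / b) \<le> entropy_term ((F $$ (i, j))\<^sup>2)"
    proof (cases "F $$ (i, j) = 0")
      case False
      then have "ln ((F $$ (i, j))\<^sup>2) \<le> ln b" using le b(1) by simp
      then have "(F $$ (i, j))\<^sup>2 * ln ((F $$ (i, j))\<^sup>2) \<le> (F $$ (i, j))\<^sup>2 * ln b"
        by (intro mult_left_mono) auto
      then show ?thesis using b(1) by (simp add: entropy_term_def ln_div)
    qed (simp add: entropy_term_def)
  qed
  also have "(\<Sum>i<n. \<Sum>j<n. (F $$ (i, j))\<^sup>2 * ln (1 / b))
      = (\<Sum>j<n. \<Sum>i<n. (F $$ (i, j))\<^sup>2) * ln (1 / b)"
    by (subst sum.swap) (simp add: sum_distrib_right)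
  also have "(\<Sum>j<n. \<Sum>i<n. (F $$ (i, j))\<^sup>2) = (\<Sum>j<n. (transpose_mat F * F) $$ (j, j))"
    using F by (intro sum.cong) (auto simp: scalar_prod_def power2_eq_square atLeast0LessThan)
  also have "\<dots> = real n" by (simp add: orth)
  finally show ?thesis .
qed

section \<open>Orthogonality of the Fourier matrices\<close>

lemma minus_one_power_binary_dot:
  "(- 1 :: real) ^ binary_dot r i j = (\<Prod>t<r. if bit i t \<and> bit j t then - 1 else 1)"
proof -
  have "(- 1 :: real) ^ (m mod 2) = (- 1) ^ m" for m :: nat
    by (cases "even m") (auto simp: even_iff_mod_2_eq_zero odd_iff_mod_2_eq_one)
  then show ?thesis
    unfolding binary_dot_def by (simp only: power_sum) (auto intro!: prod.cong)
qed

text \<open>If \<open>j\<close> and \<open>k\<close> differ in bit \<open>t\<close>, flipping bit \<open>t\<close> of \<open>i\<close> changes the sign of the summand.\<close>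

lemma sum_walsh_characters:
  assumes "j < 2 ^ r" "k < 2 ^ r"
  shows "(\<Sum>i<2 ^ r. (- 1 :: real) ^ binary_dot r i j * (- 1) ^ binary_dot r i k)
    = (if j = k then 2 ^ r else 0)"
proof (cases "j = k")
  case True
  then show ?thesis by (simp flip: power_add mult_2)
next
  case False
  then obtain t where t: "bit j t \<noteq> bit k t" by (auto simp: bit_eq_iff)
  have tr: "t < r"
  proof (rule ccontr)
    assume "\<not> t < r"
    then have "(2 :: nat) ^ r \<le> 2 ^ t" by simp
    then have "j < 2 ^ t" "k < 2 ^ t" using assms by linarith+
    then show False using t by (simp add: bit_iff_odd)
  qed
  let ?f = "\<lambda>i. (- 1 :: real) ^ binary_dot r i j * (- 1) ^ binary_dot r i k"
  have lt: "flip_bit t i < 2 ^ r" if "i < 2 ^ r" for i :: nat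
    using that tr take_bit_flip_bit_eq[of r t i] by (simp flip: take_bit_nat_eq_self_iff)
  have inv: "flip_bit t (flip_bit t i) = i" for i :: nat
    by (rule bit_eqI) (auto simp: bit_simps)
  have flip: "?f (flip_bit t i) = - ?f i" for i
  proof -
    have dot: "(- 1 :: real) ^ binary_dot r i m = (if bit i t \<and> bit m t then - 1 else 1)
        * (\<Prod>u\<in>{..<r} - {t}. if bit i u \<and> bit m u then - 1 else 1)" for i m
      unfolding minus_one_power_binary_dot using tr by (intro prod.remove) auto
    have "(\<Prod>u\<in>{..<r} - {t}. if bit (flip_bit t i) u \<and> bit m u then - 1 else 1 :: real)
        = (\<Prod>u\<in>{..<r} - {t}. if bit i u \<and> bit m u then - 1 else 1)" for m
      by (intro prod.cong) (auto simp: bit_simps)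
    then show ?thesis
      unfolding dot using t by (auto simp: bit_simps)
  qed
  \<comment> \<open>Flipping bit \<open>t\<close> is an involution of the index range, so the sum
    equals its own negative.\<close>
  have "sum ?f {..<2 ^ r} = (\<Sum>i<2 ^ r. - ?f i)"
    by (rule sum.reindex_bij_witness[of _ "flip_bit t" "flip_bit t"])
       (simp_all add: lt inv flip[symmetric] del: mult_minus_left)
  then show ?thesis using False by (simp add: sum_negf)
qed

lemma walsh_hadamard_orthogonal:
  assumes "is_walsh_hadamard_mat n F"
  shows "F \<in> carrier_mat n n" "transpose_mat F * F = 1\<^sub>m n"
    and "\<And>i j. i < n \<Longrightarrow> j < n \<Longrightarrow> (F $$ (i, j))\<^sup>2 = 1 / real n"
proof -
  obtain r where n: "n = 2 ^ r"
    and F: "F = mat n n (\<lambda>(i, j). 1 / sqrt (real n) * (- 1) ^ binary_dot r i j)"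
    using assms by (auto simp: is_walsh_hadamard_mat_def)
  show "F \<in> carrier_mat n n" by (simp add: F)
  show "(F $$ (i, j))\<^sup>2 = 1 / real n" if "i < n" "j < n" for i j
    using that by (simp add: F power_mult_distrib power_divide flip: power_mult)
  show "transpose_mat F * F = 1\<^sub>m n"
  proof (rule eq_matI)
    fix j k assume "j < dim_row (1\<^sub>m n :: real mat)" "k < dim_col (1\<^sub>m n :: real mat)"
    then have jk: "j < n" "k < n" by auto
    have "(transpose_mat F * F) $$ (j, k) = (\<Sum>i<n. F $$ (i, j) * F $$ (i, k))"
      using jk by (simp add: F scalar_prod_def atLeast0LessThan)
    also have "\<dots> = (\<Sum>i<n. (- 1) ^ binary_dot r i j * (- 1) ^ binary_dot r i k / real n)"
      using jk by (intro sum.cong) (auto simp: F)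
    also have "\<dots> = (if j = k then 1 else 0)"
      using sum_walsh_characters[of j r k] jk
      by (simp add: n flip: sum_divide_distrib)
    finally show "(transpose_mat F * F) $$ (j, k) = 1\<^sub>m n $$ (j, k)" using jk by simp
  qed (auto simp: F)
qed

text \<open>A geometric sum whose ratio has \<open>N\<close>-th power 1; the bound on
  \<open>d\<close> leaves \<open>d = 0\<close> as the only case with ratio 1.\<close>

lemma sum_roots_of_unity:
  assumes N: "0 < N" and d: "\<bar>d\<bar> < int N"
  shows "(\<Sum>k<N. cis (2 * pi * of_int d / real N) ^ k) = (if d = 0 then of_nat N else 0)"
proof (cases "d = 0")
  case False
  let ?w = "cis (2 * pi * of_int d / real N)"
  have "?w ^ N = cis (2 * pi * of_int d)" using N by (simp add: DeMoivre)
  also have "\<dots> = 1" by (simp add: cis_multiple_2pi)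
  finally have wN: "?w ^ N = 1" .
  have "?w \<noteq> 1"
  proof
    assume "?w = 1"
    then have "cos (2 * pi * of_int d / real N) = 1" by (metis cis.sel(1) one_complex.sel(1))
    then obtain m :: int where "2 * pi * of_int d / real N = of_int m * 2 * pi"
      by (auto simp: cos_one_2pi_int)
    then have "real_of_int d = of_int m * real N" using N by (simp add: field_simps)
    then have "d = m * int N" by (metis of_int_eq_iff of_int_mult of_int_of_nat_eq)
    then show False using d False by (auto simp: abs_mult)
  qed
  then show ?thesis using False wN by (simp add: sum_gp_strict)
qed simp

lemma index_dft_mat:
  assumes "k < N" "l < N"
  shows "dft_mat N $$ (k, l) = of_real (1 / sqrt (real N)) * cis (- (2 * pi * real k * real l / real N))"
  using assms by (simp add: dft_mat_def cis_conv_exp mult_ac)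

lemma dft_mat_unitary:
  assumes "p < N" "q < N"
  shows "(\<Sum>k<N. dft_mat N $$ (k, p) * cnj (dft_mat N $$ (k, q))) = (if p = q then 1 else 0)"
proof -
  have N: "0 < N" using assms by simp
  have "dft_mat N $$ (k, p) * cnj (dft_mat N $$ (k, q))
      = cis (2 * pi * of_int (int q - int p) / real N) ^ k / of_nat N" if k: "k < N" for k
  proof -
    have "dft_mat N $$ (k, p) * cnj (dft_mat N $$ (k, q))
        = of_real (1 / sqrt (real N)) * of_real (1 / sqrt (real N))
          * (cis (- (2 * pi * real k * real p / real N)) * cis (2 * pi * real k * real q / real N))"
      using assms by (simp add: index_dft_mat[OF k] cis_cnj)
    also have "of_real (1 / sqrt (real N)) * of_real (1 / sqrt (real N)) = 1 / complex_of_nat N"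
      by (simp flip: of_real_mult)
    also have "cis (- (2 * pi * real k * real p / real N)) * cis (2 * pi * real k * real q / real N)
        = cis (2 * pi * of_int (int q - int p) / real N) ^ k"
      using N by (simp add: cis_mult DeMoivre field_simps)
    finally show ?thesis by simp
  qed
  then have "(\<Sum>k<N. dft_mat N $$ (k, p) * cnj (dft_mat N $$ (k, q)))
      = (\<Sum>k<N. cis (2 * pi * of_int (int q - int p) / real N) ^ k) / of_nat N"
    by (simp add: sum_divide_distrib)
  also have "\<dots> = (if p = q then 1 else 0)"
    using assms N by (subst sum_roots_of_unity) auto
  finally show ?thesis .
qed

section \<open>The complex transform as a real matrix\<close>

lemma sum_lessThan_double:
  fixes f :: "nat \<Rightarrow> 'a::comm_monoid_add"
  shows "(\<Sum>s<N + N. f s) = (\<Sum>k<N. f k + f (N + k))"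
proof -
  have "(\<Sum>s<N + N. f s) = (\<Sum>s<N. f s) + (\<Sum>s=N..<N + N. f s)"
    by (metis atLeast0LessThan le_add1 sum.atLeastLessThan_concat zero_le)
  also have "(\<Sum>s=N..<N + N. f s) = (\<Sum>k<N. f (N + k))"
    using sum.shift_bounds_nat_ivl[of f 0 N N] by (simp add: atLeast0LessThan add.commute)
  finally show ?thesis by (simp add: sum.distrib)
qed

text \<open>Since \<open>Re (x * cnj y) = Re x * Re y + Im x * Im y\<close>, storage turns the real
  part of the Hermitian product into the Euclidean one; \<open>\<sigma>\<close> only reorders the
  sum.\<close>

lemma sum_mult_store_complex:
  assumes "\<sigma> permutes {..<n}" "even n"
  shows "(\<Sum>i<n. store_complex n \<sigma> z $ i * store_complex n \<sigma> w $ i)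
    = Re (\<Sum>k<n div 2. z $ k * cnj (w $ k))"
proof -
  let ?N = "n div 2"
  let ?f = "\<lambda>s. (if s < ?N then Re (z $ s) else Im (z $ (s - ?N)))
    * (if s < ?N then Re (w $ s) else Im (w $ (s - ?N)))"
  have n: "n = ?N + ?N" using assms(2) by auto
  have "(\<Sum>i<n. store_complex n \<sigma> z $ i * store_complex n \<sigma> w $ i) = (\<Sum>i<n. ?f (\<sigma> i))"
    by (intro sum.cong) (auto simp: store_complex_def)
  also have "\<dots> = (\<Sum>s<n. ?f s)"
    using sum.permute[OF assms(1), of ?f] by (simp add: o_def)
  also have "\<dots> = (\<Sum>k<?N. ?f k + ?f (?N + k))"
    by (subst n) (rule sum_lessThan_double)
  also have "\<dots> = (\<Sum>k<?N. Re (z $ k * cnj (w $ k)))"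
    by (intro sum.cong) auto
  finally show ?thesis by simp
qed

text \<open>Each real unit vector stores 1 or \<i> times a complex unit vector, so the columns of
  \<open>F\<close> store such multiples of the columns of a unitary matrix. Each entry of
  \<open>F\<close> is a real or imaginary part of a number of modulus
  \<open>sqrt (2 / n)\<close>.\<close>

lemma real_dft_orthogonal:
  assumes "is_real_dft_mat n F"
  shows "F \<in> carrier_mat n n" "transpose_mat F * F = 1\<^sub>m n"
    and "\<And>i j. i < n \<Longrightarrow> j < n \<Longrightarrow> (F $$ (i, j))\<^sup>2 \<le> 2 / real n"
proof -
  let ?N = "n div 2" and ?D = "dft_mat (n div 2)"
  obtain \<sigma> where ev: "even n" and F: "F \<in> carrier_mat n n" and \<sigma>: "\<sigma> permutes {..<n}"
    and FD: "\<And>x. x \<in> carrier_vec ?N \<Longrightarrow>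
      F *\<^sub>v store_complex n \<sigma> x = store_complex n \<sigma> (?D *\<^sub>v x)"
    using assms by (auto simp: is_real_dft_mat_def)
  show "F \<in> carrier_mat n n" by (fact F)
  \<comment> \<open>Coordinate \<open>j\<close> holds the real part of complex entry
    \<open>\<kappa> j\<close> if \<open>u j = 1\<close>, and its imaginary part if
    \<open>u j = \<i>\<close>.\<close>
  define u where "u j = (if \<sigma> j < ?N then 1 else \<i>)" for j
  define \<kappa> where "\<kappa> j = (if \<sigma> j < ?N then \<sigma> j else \<sigma> j - ?N)" for j
  have D: "?D \<in> carrier_mat ?N ?N" by (simp add: dft_mat_def)
  have \<sigma>n: "\<sigma> j < n" if "j < n" for j using permutes_in_image[OF \<sigma>, of j] that by simp
  have \<kappa>: "\<kappa> j < ?N" if "j < n" for j using \<sigma>n[OF that] ev by (auto simp: \<kappa>_def)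
  have inj: "\<sigma> i = \<sigma> j \<longleftrightarrow> i = j" for i j using permutes_inj[OF \<sigma>] by (auto dest: injD)
  have store: "store_complex n \<sigma> (u j \<cdot>\<^sub>v unit_vec ?N (\<kappa> j)) = unit_vec n j" if "j < n" for j
  proof (rule eq_vecI)
    fix i assume "i < dim_vec (unit_vec n j :: real vec)"
    then have i: "i < n" by simp
    have e: "(u j \<cdot>\<^sub>v unit_vec ?N (\<kappa> j)) $ k = (if k = \<kappa> j then u j else 0)" if "k < ?N" for k
      using that \<kappa>[OF \<open>j < n\<close>] by simp
    have "store_complex n \<sigma> (u j \<cdot>\<^sub>v unit_vec ?N (\<kappa> j)) $ i
        = (let z = (if \<kappa> i = \<kappa> j then u j else 0) in if \<sigma> i < ?N then Re z else Im z)"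
      using i \<kappa>[OF i] e[of "\<kappa> i"] unfolding store_complex_def Let_def
      by (cases "\<sigma> i < ?N") (simp_all only: \<kappa>_def if_True if_False index_vec)
    also have "\<dots> = (if \<sigma> i = \<sigma> j then 1 else 0)"
      unfolding Let_def u_def \<kappa>_def by simp linarith
    finally show "store_complex n \<sigma> (u j \<cdot>\<^sub>v unit_vec ?N (\<kappa> j)) $ i = unit_vec n j $ i"
      using i that by (simp add: inj)
  qed (simp add: store_complex_def)
  define z where "z j = ?D *\<^sub>v (u j \<cdot>\<^sub>v unit_vec ?N (\<kappa> j))" for j
  have z: "z j $ k = u j * ?D $$ (k, \<kappa> j)" if "k < ?N" "j < n" for k j
  proof -
    have "z j $ k = (\<Sum>s<?N. if s = \<kappa> j then u j * ?D $$ (k, \<kappa> j) else 0)"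
      unfolding z_def using that D \<kappa>[OF that(2)]
      by (simp add: scalar_prod_def unit_vec_def atLeast0LessThan del: sum.delta sum.delta')
         (intro sum.cong, auto)
    then show ?thesis using \<kappa>[OF that(2)] by simp
  qed
  have Fz: "F $$ (i, j) = store_complex n \<sigma> (z j) $ i" if "i < n" "j < n" for i j
  proof -
    have "store_complex n \<sigma> (z j) = F *\<^sub>v unit_vec n j"
      using FD[of "u j \<cdot>\<^sub>v unit_vec ?N (\<kappa> j)"] that by (simp add: store z_def)
    then show ?thesis
      using F that by (simp add: scalar_prod_def unit_vec_def if_distrib cong: if_cong)
  qed
  have orth: "(\<Sum>i<n. F $$ (i, p) * F $$ (i, q)) = (if p = q then 1 else 0)"
    if pq: "p < n" "q < n" for p q
  proof -
    have "(\<Sum>i<n. F $$ (i, p) * F $$ (i, q))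
        = (\<Sum>i<n. store_complex n \<sigma> (z p) $ i * store_complex n \<sigma> (z q) $ i)"
      using pq by (intro sum.cong) (auto simp: Fz)
    also have "\<dots> = Re (\<Sum>k<?N. z p $ k * cnj (z q $ k))"
      by (rule sum_mult_store_complex[OF \<sigma> ev])
    also have "(\<Sum>k<?N. z p $ k * cnj (z q $ k))
        = u p * cnj (u q) * (\<Sum>k<?N. ?D $$ (k, \<kappa> p) * cnj (?D $$ (k, \<kappa> q)))"
      using pq by (auto simp: z sum_distrib_left intro!: sum.cong)
    also have "\<dots> = u p * cnj (u q) * (if \<kappa> p = \<kappa> q then 1 else 0)"
      using pq by (simp add: dft_mat_unitary \<kappa>)
    \<comment> \<open>If \<open>p \<noteq> q\<close> but \<open>\<kappa> p = \<kappa> q\<close>, one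
      of \<open>u p\<close> and \<open>u q\<close> is 1 and the other \<i>, so the product is purely
      imaginary.\<close>
    also have "Re \<dots> = (if p = q then 1 else 0)"
      using inj[of p q] by (auto simp: u_def \<kappa>_def split: if_splits)
    finally show ?thesis .
  qed
  show "transpose_mat F * F = 1\<^sub>m n"
    using F by (intro eq_matI) (auto simp: scalar_prod_def atLeast0LessThan orth)
  show "(F $$ (i, j))\<^sup>2 \<le> 2 / real n" if ij: "i < n" "j < n" for i j
  proof -
    have "\<bar>F $$ (i, j)\<bar> \<le> cmod (z j $ \<kappa> i)"
      using ij abs_Re_le_cmod abs_Im_le_cmod by (simp add: Fz store_complex_def \<kappa>_def)
    also have "\<dots> = cmod (u j * ?D $$ (\<kappa> i, \<kappa> j))" using ij \<kappa> by (simp add: z)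
    also have "\<dots> = 1 / sqrt (real ?N)"
      using \<kappa> ij by (simp add: index_dft_mat norm_mult u_def norm_divide)
    finally have "\<bar>F $$ (i, j)\<bar>\<^sup>2 \<le> (1 / sqrt (real ?N))\<^sup>2" by (intro power_mono) auto
    also have "\<dots> = 2 / real n" using ev by (auto simp: power_divide elim!: evenE)
    finally show ?thesis by simp
  qed
qed

section \<open>The lower bound\<close>

text \<open>The Fourier matrix of order 1 gives the 2 by 2 identity, which the empty circuit
  computes without rotations although \<open>n * log 2 n = 2\<close>; this case has to be
  excluded.\<close>

theorem theorem1:
  shows "\<exists>c::real. c > 0 \<and>
    (\<forall>(n::nat) (R::real) (F::real mat) (C::circuit) (a::real).
       even n \<longrightarrow> R > 1 \<longrightarrow>
       is_fourier_mat n F \<longrightarrow> \<not> (n = 2 \<and> is_real_dft_mat n F) \<longrightarrow>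
       circuit_on n C \<longrightarrow> uniformly_well_conditioned n R C \<longrightarrow>
       a \<noteq> 0 \<longrightarrow> defining_mat n C (length C) = a \<cdot>\<^sub>m F \<longrightarrow>
       real (num_rotations C) \<ge> c * inverse R * real n * log 2 (real n))"
\<comment> \<open>The 16 is the cost 8 per rotation times the 2 lost in the lower bound
  \<open>n * ln n / 2\<close>; \<open>ln 2\<close> converts to base 2.\<close>
proof (intro exI[of _ "ln 2 / 16"] conjI allI impI)
  show "0 < ln 2 / (16 :: real)" by simp
  fix n R F C and a :: real
  assume ev: "even n" and R: "R > 1" and F: "is_fourier_mat n F"
    and n2: "\<not> (n = 2 \<and> is_real_dft_mat n F)" and C: "circuit_on n C"
    and W: "uniformly_well_conditioned n R C" and a: "a \<noteq> 0"
    and eq: "defining_mat n C (length C) = a \<cdot>\<^sub>m F"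
  obtain B where B: "mat_inverse (a \<cdot>\<^sub>m F) = Some B" "B \<in> carrier_mat n n" "(a \<cdot>\<^sub>m F) * B = 1\<^sub>m n"
    using mat_inverse_defining_mat[OF C order_refl] unfolding eq by blast
  have upper: "quasi_entropy n (a \<cdot>\<^sub>m F) B \<le> 8 * R * real (num_rotations C)"
    using quasi_entropy_defining_mat_le[OF C W order_refl] by (simp add: eq B(1) num_rotations_def)
  have lower: "real n * ln (real n) / 2 \<le> quasi_entropy n (a \<cdot>\<^sub>m F) B"
  proof (cases "n = 0")
    case True
    then show ?thesis by (simp add: quasi_entropy_def)
  next
    case False
    then have n: "2 \<le> n" using ev by (metis One_nat_def dvd_1_iff_1 even_Suc_Suc_iff less_2_cases_iff not_less odd_one)
    show ?thesis
    proof (cases "is_walsh_hadamard_mat n F")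
      case True
      note wh = walsh_hadamard_orthogonal[OF True]
      have "real n * ln (1 / (1 / real n)) \<le> quasi_entropy n (a \<cdot>\<^sub>m F) B"
        using n by (intro quasi_entropy_orthogonal_ge[OF wh(1) a wh(2) B(2,3)]) (auto simp: wh(3))
      moreover have "0 \<le> real n * ln (real n)" using n by simp
      ultimately show ?thesis by simp
    next
      case False
      with F have dft: "is_real_dft_mat n F" by (simp add: is_fourier_mat_def)
      note d = real_dft_orthogonal[OF dft]
      \<comment> \<open>The exclusion of the 2 by 2 identity enters here.\<close>
      have n4: "4 \<le> n" using n n2 dft ev by (cases "n = 2 \<or> n = 3") auto
      \<comment> \<open>From 4 on, \<open>n / 2\<close> is at least the square root of
        \<open>n\<close>, so \<open>ln (n / 2)\<close> is at least half of
        \<open>ln n\<close>.\<close>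
      have "ln (real n) \<le> ln ((real n / 2)\<^sup>2)"
        using n4 by (simp add: power2_eq_square field_simps)
      then have "ln (real n) / 2 \<le> ln (1 / (2 / real n))"
        using n4 by (simp add: ln_realpow)
      then have "real n * (ln (real n) / 2) \<le> real n * ln (1 / (2 / real n))"
        by (intro mult_left_mono) auto
      also have "\<dots> \<le> quasi_entropy n (a \<cdot>\<^sub>m F) B"
        using n by (intro quasi_entropy_orthogonal_ge[OF d(1) a d(2) B(2,3)]) (auto simp: d(3))
      finally show ?thesis by simp
    qed
  qed
  have "real n * ln (real n) \<le> 16 * R * real (num_rotations C)" using lower upper by simp
  then have "real n * ln (real n) / (16 * R) \<le> real (num_rotations C)"
    using R by (simp add: field_simps)
  also have "real n * ln (real n) / (16 * R) = ln 2 / 16 * inverse R * real n * log 2 (real n)"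
    using R by (simp add: log_def field_simps)
  finally show "ln 2 / 16 * inverse R * real n * log 2 (real n) \<le> real (num_rotations C)" .
qed

end
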